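(* Let $p\ge 1$. Suppose that indicators $Y^t=(Y_1^t,\dots,Y_p^t)'$ at times $t=0,1,2,\dots$ are related to $m=2$ latent factors $\eta^t=(\eta_1^t,\eta_2^t)'$ by $$Y^t=\Lambda\eta^t+\varepsilon,$$ where $\Lambda$ is a fixed $p\times 2$ matrix and $\varepsilon$ is a $p\times 1$ vector of independent normally distributed random variables, and that for $t\ge1$ $$\eta^t=B\eta^{t-1}+W^t,$$ where $B$ is a fixed $2\times 2$ matrix and the $2\times 1$ random vectors $W^t$ are independently normally distributed with potentially distinct parameters at each $t$. Let $B=QDQ^{-1}$ be the Jordan decomposition of $B$, with $Q$ invertible and $D$ a $2\times2$ matrix in Jordan normal form. Suppose that (i) as $t\to\infty$, $Y^t$ converges in distribution to some random variable $Y^*$; (ii) $B$ is invertible; (iii) the random variables $W^t$ decay sufficiently quickly that, as $t\to\infty$, $\sum_{k=1}^{t}B^{-k}W^k$ converges in distribution to some normally distributed random variable $W^*$. Then, as $t\to\infty$, the resulting limiting factor model $$Y^*=\Lambda^*\eta^*+\varepsilon$$ is such that $\dim(\eta^* )=2$ if and only if $B=I$ (the $2\times 2$ identity matrix).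
   Context: Here a prime denotes transpose. The superscript $t$ on $Y^t,\eta^t,W^t$ is a time index, while $B^t$, $D^t$, $B^{-k}$ denote matrix powers. The $(i,j)$ entry of $B$ represents the causal effect on factor $i$ at time $t$ of factor $j$ at time $t-1$. The resulting limiting factor model is the representation of $Y^*$ as a loading matrix $\Lambda^*$ times a random vector of factors $\eta^*$ plus $\varepsilon$, in which the dimensionality (number) of the factors is $\dim(\eta^* )=\operatorname{rank}(D^* )$, where $D^*=\lim_{t\to\infty}D^t$. *)

theory Defs
  imports "HOL-Probability.Probability"
begin

text \<open>On vectors of vectors the library's multiplication (and hence \<open>^\<close>) is componentwise,
  so powers for the matrix product are defined separately.\<close>

primrec matpow :: "'a::semiring_1^'n^'n \<Rightarrow> nat \<Rightarrow> 'a^'n^'n" where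
  "matpow A 0 = mat 1"
| "matpow A (Suc k) = A ** matpow A k"

abbreviation cmat :: "real^'n^'m \<Rightarrow> complex^'n^'m" where
  "cmat \<equiv> map_matrix complex_of_real"

text \<open>A 2 by 2 matrix in Jordan normal form: two Jordan blocks of size 1, or one block of size 2.\<close>

definition jordan_form2 :: "complex^2^2 \<Rightarrow> bool" where
  "jordan_form2 D \<longleftrightarrow>
     D $ 2 $ 1 = 0 \<and> (D $ 1 $ 2 = 0 \<or> (D $ 1 $ 2 = 1 \<and> D $ 1 $ 1 = D $ 2 $ 2))"

text \<open>Convergence in distribution for random variables with values in a Euclidean space (the
  library's \<open>weak_conv_m\<close> covers real-valued ones only); the limit may live on another
  probability space.\<close>

definition converges_in_distribution ::
  "'a measure \<Rightarrow> (nat \<Rightarrow> 'a \<Rightarrow> 'v::euclidean_space) \<Rightarrow> 'b measure \<Rightarrow> ('b \<Rightarrow> 'v) \<Rightarrow> bool" where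
  "converges_in_distribution M X N Z \<longleftrightarrow>
     (\<forall>t. X t \<in> borel_measurable M) \<and> Z \<in> borel_measurable N \<and>
     (\<forall>g :: 'v \<Rightarrow> real. continuous_on UNIV g \<and> bounded (range g) \<longrightarrow>
        (\<lambda>t. \<integral>\<omega>. g (X t \<omega>) \<partial>M) \<longlonglongrightarrow> (\<integral>\<omega>. g (Z \<omega>) \<partial>N))"

text \<open>Variance zero and singular covariance matrices are allowed.\<close>

definition normal_rv :: "'a measure \<Rightarrow> ('a \<Rightarrow> real) \<Rightarrow> bool" where
  "normal_rv M X \<longleftrightarrow> X \<in> borel_measurable M \<and>
     ((\<exists>\<mu> \<sigma>. \<sigma> > 0 \<and> distributed M lborel X (normal_density \<mu> \<sigma>)) \<or> (\<exists>\<mu>. AE \<omega> in M. X \<omega> = \<mu>))"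

definition multivariate_normal :: "'a measure \<Rightarrow> ('a \<Rightarrow> 'v::euclidean_space) \<Rightarrow> bool" where
  "multivariate_normal M X \<longleftrightarrow>
     X \<in> borel_measurable M \<and> (\<forall>a. normal_rv M (\<lambda>\<omega>. a \<bullet> X \<omega>))"

text \<open>
  Since \<open>\<eta>\<^sup>t = B\<^sup>t (\<eta>\<^sup>0 + (\<Sum>k=1..t. B\<^sup>-\<^sup>k W\<^sup>k))\<close> and \<open>B\<^sup>t = Q D\<^sup>t Q\<^sup>-\<^sup>1\<close>, passing to the limit
  with \<open>D\<^sup>* = lim D\<^sup>t\<close> gives \<open>Y\<^sup>* = \<Lambda> Q D\<^sup>* Q\<^sup>-\<^sup>1 (\<eta>\<^sup>0 + W\<^sup>*) + \<epsilon>\<close>. Factoring \<open>Q D\<^sup>* Q\<^sup>-\<^sup>1 = C G\<close>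
  through dimension \<open>r = rank D\<^sup>*\<close> yields the loading matrix \<open>\<Lambda>\<^sup>* = \<Lambda> C\<close> and the
  vector of \<open>r\<close> factors \<open>\<eta>\<^sup>* = G (\<eta>\<^sup>0 + W\<^sup>*)\<close>. As \<open>r\<close> is a variable, \<open>C\<close> and \<open>\<Lambda>\<^sup>*\<close> are given
  by their columns, \<open>G\<close> by its rows and \<open>\<eta>\<^sup>*\<close> by its entries, each indexed by \<open>j < r\<close>.
  \<open>Y\<^sup>*\<close> and \<open>W\<^sup>*\<close> are determined only as limits in distribution, hence enter through their
  laws \<open>\<mu>Y\<close> and \<open>\<mu>W\<close>. If \<open>D\<^sup>t\<close> does not converge there is no limiting factor model.
\<close>

definition limiting_factor_model ::
  "'a measure \<Rightarrow> real^2^'p \<Rightarrow> complex^2^2 \<Rightarrow> complex^2^2 \<Rightarrow> ('a \<Rightarrow> real^2) \<Rightarrow> ('a \<Rightarrow> real^'p) \<Rightarrow>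
   (real^2) measure \<Rightarrow> (real^'p) measure \<Rightarrow> nat \<Rightarrow> (nat \<Rightarrow> real^'p) \<Rightarrow> (nat \<Rightarrow> 'a \<Rightarrow> real) \<Rightarrow> bool" where
  "limiting_factor_model M \<Lambda> Q D \<eta>0 \<epsilon> \<mu>W \<mu>Y r \<Lambda>star \<eta>star \<longleftrightarrow>
     (\<exists>Dstar C G Winf.
        (\<lambda>t. matpow D t) \<longlonglongrightarrow> Dstar \<and>
        r = rank Dstar \<and>
        cmat (\<chi> i k. \<Sum>j<r. C j $ i * G j $ k) = Q ** Dstar ** matrix_inv Q \<and>
        Winf \<in> borel_measurable M \<and> distr M borel Winf = \<mu>W \<and>
        (\<forall>j<r. \<Lambda>star j = \<Lambda> *v C j) \<and>
        (\<forall>j<r. \<forall>\<omega>\<in>space M. \<eta>star j \<omega> = G j \<bullet> (\<eta>0 \<omega> + Winf \<omega>)) \<and>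
        distr M borel (\<lambda>\<omega>. (\<Sum>j<r. \<eta>star j \<omega> *\<^sub>R \<Lambda>star j) + \<epsilon> \<omega>) = \<mu>Y)"

end

theory Submission
  imports Defs
begin

text \<open>If \<open>rank D\<^sup>* = 2\<close>, then \<open>D D\<^sup>* = D\<^sup>*\<close> forces \<open>D = I\<close> and hence \<open>B = I\<close>. Conversely, for
  \<open>B = I\<close> the factors are \<open>\<eta>\<^sup>t = \<eta>\<^sup>0 + (\<Sum>k=1..t. W\<^sup>k)\<close>, and the point is to realise \<open>W\<^sup>*\<close> on the
  original probability space, jointly with \<open>\<eta>\<^sup>0\<close> and \<open>\<epsilon>\<close>. As in the Levy equivalence theorem, partial
  sums of independent variables that converge in law are Cauchy in probability: the characteristic
  function of an increment is a quotient of characteristic functions of partial sums and so tends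
  to 1 near 0. Hence a subsequence converges almost surely, and its limit has the law
  of \<open>W\<^sup>*\<close>.\<close>

section \<open>Laws and convergence in distribution\<close>

text \<open>The indicator of a closed set is a pointwise limit of bounded continuous functions, so
  by dominated convergence the laws agree on closed sets, an intersection-stable generator of the
  Borel sets.\<close>

lemma distr_eqI_bounded_continuous:
  fixes X :: "'a \<Rightarrow> 'v::metric_space" and Z :: "'b \<Rightarrow> 'v"
  assumes "prob_space M" "prob_space N"
    and [measurable]: "X \<in> borel_measurable M" "Z \<in> borel_measurable N"
    and eq: "\<And>g :: 'v \<Rightarrow> real. continuous_on UNIV g \<Longrightarrow> bounded (range g) \<Longrightarrow>
               (\<integral>x. g (X x) \<partial>M) = (\<integral>x. g (Z x) \<partial>N)"
  shows "distr M borel X = distr N borel Z"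
proof -
  interpret M: prob_space M by fact
  interpret N: prob_space N by fact
  interpret X: prob_space "distr M borel X" by (rule M.prob_space_distr) simp
  interpret Z: prob_space "distr N borel Z" by (rule N.prob_space_distr) simp
  have closed_eq: "emeasure (distr M borel X) C = emeasure (distr N borel Z) C" if "closed C" for C
  proof (cases "C = {}")
    case False
    \<comment> \<open>\<open>g n\<close> is 1 on \<open>C\<close> and tends to 0 off
      \<open>C\<close>, where closedness makes the distance positive. The empty set is treated apart
      because \<open>infdist x {}\<close> is 0 by convention, which would make \<open>g n\<close>
      constantly 1.\<close>
    define g where "g n x = max 0 (1 - real n * infdist x C)" for n x
    have g_bounds: "0 \<le> g n x" "g n x \<le> 1" for n x
      by (auto simp: g_def infdist_nonneg)
    have g_cont: "continuous_on UNIV (g n)" for n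
      unfolding g_def by (intro continuous_intros)
    have [measurable]: "g n \<in> borel_measurable borel" for n
      using g_cont by (rule borel_measurable_continuous_onI)
    have [measurable]: "C \<in> sets borel" using that by simp
    have g_lim: "(\<lambda>n. g n x) \<longlonglongrightarrow> indicator C x" for x
    proof (cases "x \<in> C")
      case True
      then show ?thesis by (simp add: g_def)
    next
      case x: False
      then have pos: "infdist x C > 0"
        using in_closed_iff_infdist_zero[OF that False] infdist_nonneg[of x C] by force
      obtain n0 where n0: "real n0 * infdist x C > 1"
        using reals_Archimedean3[OF pos] by blast
      have "g n x = 0" if "n \<ge> n0" for n
      proof -
        have "real n0 * infdist x C \<le> real n * infdist x C"
          using that by (intro mult_right_mono) (auto simp: infdist_nonneg)
        then show ?thesis using n0 by (simp add: g_def)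
      qed
      then have "eventually (\<lambda>n. g n x = 0) sequentially"
        by (auto simp: eventually_sequentially)
      then show ?thesis using x by (simp add: tendsto_eventually)
    qed
    have "(\<lambda>n. \<integral>x. g n (X x) \<partial>M) \<longlonglongrightarrow> (\<integral>x. indicator C (X x) \<partial>M)"
      by (rule integral_dominated_convergence[where w = "\<lambda>_. 1"])
         (auto simp: g_bounds intro: g_lim)
    moreover have "(\<lambda>n. \<integral>x. g n (Z x) \<partial>N) \<longlonglongrightarrow> (\<integral>x. indicator C (Z x) \<partial>N)"
      by (rule integral_dominated_convergence[where w = "\<lambda>_. 1"])
         (auto simp: g_bounds intro: g_lim)
    moreover have "(\<integral>x. g n (X x) \<partial>M) = (\<integral>x. g n (Z x) \<partial>N)" for n
      by (intro eq g_cont boundedI[where B = 1]) (auto simp: g_bounds)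
    ultimately have "(\<integral>x. indicat_real C (X x) \<partial>M) = (\<integral>x. indicat_real C (Z x) \<partial>N)"
      using LIMSEQ_unique by simp
    moreover have "(\<integral>x. indicator C (X x) \<partial>M) = measure (distr M borel X) C"
      by (subst integral_distr[of X M borel "indicator C :: _ \<Rightarrow> real", symmetric]) auto
    moreover have "(\<integral>x. indicator C (Z x) \<partial>N) = measure (distr N borel Z) C"
      by (subst integral_distr[of Z N borel "indicator C :: _ \<Rightarrow> real", symmetric]) auto
    ultimately show ?thesis
      by (simp add: X.emeasure_eq_measure Z.emeasure_eq_measure)
  qed simp
  show ?thesis
  proof (rule measure_eqI_generator_eq[where E = "Collect closed" and \<Omega> = UNIV and A = "\<lambda>_. UNIV"])
    show "Int_stable (Collect closed :: 'v set set)"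
      by (auto simp: Int_stable_def)
    show "sets (distr M borel X) = sigma_sets UNIV (Collect closed)"
      "sets (distr N borel Z) = sigma_sets UNIV (Collect closed)"
      by (simp_all add: borel_eq_closed)
  qed (use closed_eq in auto)
qed

text \<open>The integrals along the subsequence converge to those of \<open>V\<close> by dominated
  convergence and to those of \<open>Z\<close> by hypothesis. This identifies the laws of limits
  built on \<open>M\<close> itself, both for the accumulated noise and for the indicators.\<close>

lemma converges_in_distribution_AE_limit:
  fixes X :: "nat \<Rightarrow> 'a \<Rightarrow> 'v::euclidean_space" and Z :: "'b \<Rightarrow> 'v"
  assumes "prob_space M" "prob_space N"
    and conv: "converges_in_distribution M X N Z" and r: "strict_mono r"
    and [measurable]: "V \<in> borel_measurable M"
    and AE_lim: "AE \<omega> in M. (\<lambda>n. X (r n) \<omega>) \<longlonglongrightarrow> V \<omega>"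
  shows "distr M borel V = distr N borel Z"
proof (rule distr_eqI_bounded_continuous[OF assms(1,2)])
  interpret M: prob_space M by fact
  have [measurable]: "X t \<in> borel_measurable M" for t
    using conv by (auto simp: converges_in_distribution_def)
  show "V \<in> borel_measurable M" "Z \<in> borel_measurable N"
    using conv by (auto simp: converges_in_distribution_def)
  fix g :: "'v \<Rightarrow> real" assume g: "continuous_on UNIV g" "bounded (range g)"
  have [measurable]: "g \<in> borel_measurable borel"
    using g(1) by (rule borel_measurable_continuous_onI)
  obtain K where K: "\<And>x. norm (g x) \<le> K"
    using g(2) by (auto simp: bounded_iff)
  have g_isCont: "isCont g x" for x
    using g(1) by (simp add: continuous_on_eq_continuous_at)
  have "(\<lambda>n. \<integral>\<omega>. g (X (r n) \<omega>) \<partial>M) \<longlonglongrightarrow> (\<integral>\<omega>. g (V \<omega>) \<partial>M)"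
  proof (rule integral_dominated_convergence[where w = "\<lambda>_. K"])
    show "AE \<omega> in M. (\<lambda>n. g (X (r n) \<omega>)) \<longlonglongrightarrow> g (V \<omega>)"
      using AE_lim by eventually_elim (rule isCont_tendsto_compose[OF g_isCont])
  qed (use K in auto)
  moreover have "(\<lambda>n. \<integral>\<omega>. g (X (r n) \<omega>) \<partial>M) \<longlonglongrightarrow> (\<integral>\<omega>. g (Z \<omega>) \<partial>N)"
    using LIMSEQ_subseq_LIMSEQ[OF _ r, of "\<lambda>t. \<integral>\<omega>. g (X t \<omega>) \<partial>M"] conv g
    by (auto simp: converges_in_distribution_def comp_def)
  ultimately show "(\<integral>\<omega>. g (V \<omega>) \<partial>M) = (\<integral>\<omega>. g (Z \<omega>) \<partial>N)"
    by (rule LIMSEQ_unique)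
qed

lemma converges_in_distribution_compose:
  assumes conv: "converges_in_distribution M X N Z" and h: "continuous_on UNIV h"
  shows "converges_in_distribution M (\<lambda>t \<omega>. h (X t \<omega>)) N (\<lambda>\<omega>. h (Z \<omega>))"
proof -
  have [measurable]: "h \<in> borel_measurable borel"
    using h by (rule borel_measurable_continuous_onI)
  have [measurable]: "X t \<in> borel_measurable M" "Z \<in> borel_measurable N" for t
    using conv by (auto simp: converges_in_distribution_def)
  have "(\<lambda>t. \<integral>\<omega>. g (h (X t \<omega>)) \<partial>M) \<longlonglongrightarrow> (\<integral>\<omega>. g (h (Z \<omega>)) \<partial>N)"
    if g: "continuous_on UNIV g" "bounded (range g)" for g :: "_ \<Rightarrow> real"
  proof -
    have "continuous_on UNIV (\<lambda>x. g (h x))"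
      by (rule continuous_on_compose2[OF g(1) h]) auto
    moreover have "bounded (range (\<lambda>x. g (h x)))"
      using g(2) by (rule bounded_subset) auto
    ultimately show ?thesis
      using conv unfolding converges_in_distribution_def by blast
  qed
  then show ?thesis
    by (simp add: converges_in_distribution_def)
qed

section \<open>Characteristic functions near and away from the origin\<close>

text \<open>The real and imaginary parts are integrals of cosine and sine, which are bounded
  continuous test functions.\<close>

lemma converges_in_distribution_char:
  fixes Z :: "'b \<Rightarrow> real"
  assumes "prob_space M" "prob_space N"
    and conv: "converges_in_distribution M X N Z"
  shows "(\<lambda>t. char (distr M borel (X t)) u) \<longlonglongrightarrow> char (distr N borel Z) u"
proof -
  interpret M: prob_space M by fact
  interpret N: prob_space N by fact
  have [measurable]: "X t \<in> borel_measurable M" "Z \<in> borel_measurable N" for t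
    using conv by (auto simp: converges_in_distribution_def)
  have lim: "(\<lambda>t. \<integral>\<omega>. g (u * X t \<omega>) \<partial>M) \<longlonglongrightarrow> (\<integral>\<omega>. g (u * Z \<omega>) \<partial>N)"
    if "continuous_on UNIV g" "\<And>x. \<bar>g x\<bar> \<le> 1" for g :: "real \<Rightarrow> real"
  proof -
    have "continuous_on UNIV (\<lambda>x. g (u * x))"
      by (intro continuous_on_compose2[OF that(1)] continuous_intros) auto
    moreover have "bounded (range (\<lambda>x. g (u * x)))"
      using that(2) by (auto intro!: boundedI[where B = 1])
    ultimately show ?thesis
      using conv unfolding converges_in_distribution_def by blast
  qed
  have char_eq: "char (distr P borel V) u = Complex (\<integral>\<omega>. cos (u * V \<omega>) \<partial>P) (\<integral>\<omega>. sin (u * V \<omega>) \<partial>P)"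
    if "prob_space P" and [measurable]: "V \<in> borel_measurable P" for P :: "'z measure" and V
  proof -
    interpret P: prob_space P by fact
    have "integrable P (\<lambda>\<omega>. iexp (u * V \<omega>))"
      by (rule P.integrable_const_bound[where B = 1]) (auto simp del: of_real_mult)
    then show ?thesis
      by (simp add: char_def integral_distr complex_eq_iff integral_Re[symmetric] integral_Im[symmetric] Re_exp Im_exp)
  qed
  have "(\<lambda>t. Complex (\<integral>\<omega>. cos (u * X t \<omega>) \<partial>M) (\<integral>\<omega>. sin (u * X t \<omega>) \<partial>M))
      \<longlonglongrightarrow> Complex (\<integral>\<omega>. cos (u * Z \<omega>) \<partial>N) (\<integral>\<omega>. sin (u * Z \<omega>) \<partial>N)"
    by (intro tendsto_Complex lim continuous_intros) auto
  then show ?thesis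
    by (simp add: char_eq assms(1,2))
qed

text \<open>Propagates convergence of characteristic functions from a neighbourhood of 0 to the whole line.\<close>

lemma (in real_distribution) one_minus_Re_char_double:
  "1 - Re (char M (2 * u)) \<le> 4 * (1 - Re (char M u))"
proof -
  have int: "integrable M (\<lambda>x. cos (v * x))" "integrable M (\<lambda>x. iexp (v * x))" for v
    by (rule integrable_const_bound[where B = 1]; simp del: of_real_mult)+
  have Re_char: "1 - Re (char M v) = (\<integral>x. 1 - cos (v * x) \<partial>M)" for v
    using int[of v] prob_space
    by (simp add: char_def integral_Re[symmetric] Re_exp del: space_eq_univ)
  have "1 - cos (2 * u * x) \<le> 4 * (1 - cos (u * x))" for x
  proof -
    \<comment> \<open>The constant 4 arises here: the double angle formula gives a factor 2, and
      \<open>1 + cos (u * x)\<close> contributes at most another 2.\<close>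
    have "1 - cos (2 * (u * x)) = 2 * ((1 + cos (u * x)) * (1 - cos (u * x)))"
      by (simp only: cos_double_cos) (simp add: algebra_simps power2_eq_square)
    also have "\<dots> \<le> 2 * (2 * (1 - cos (u * x)))"
      by (intro mult_left_mono mult_right_mono) auto
    finally show ?thesis by (simp add: mult.assoc)
  qed
  then have "(\<integral>x. 1 - cos (2 * u * x) \<partial>M) \<le> (\<integral>x. 4 * (1 - cos (u * x)) \<partial>M)"
    using int(1)[of u] int(1)[of "2 * u"] by (intro integral_mono) auto
  then show ?thesis
    unfolding Re_char integral_mult_right_zero .
qed

text \<open>By the doubling inequality, convergence on an interval around 0 extends to the interval
  of twice the radius; repeated doubling of \<delta> reaches every \<open>u\<close>.\<close>

lemma char_tendsto_1_everywhere:
  assumes \<mu>: "\<And>k. real_distribution (\<mu> k)" and "\<delta> > 0"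
    and near: "\<And>u. \<bar>u\<bar> \<le> \<delta> \<Longrightarrow> (\<lambda>k. char (\<mu> k) u) \<longlonglongrightarrow> 1"
  shows "(\<lambda>k. char (\<mu> k) u) \<longlonglongrightarrow> 1"
proof -
  interpret \<mu>: real_distribution "\<mu> k" for k by (rule \<mu>)
  have dyadic: "(\<lambda>k. char (\<mu> k) u) \<longlonglongrightarrow> 1" if "\<bar>u\<bar> \<le> 2 ^ n * \<delta>" for n u
    using that
  proof (induction n arbitrary: u)
    case 0
    then show ?case using near by simp
  next
    case (Suc n)
    have "(\<lambda>k. char (\<mu> k) (u / 2)) \<longlonglongrightarrow> 1"
      using Suc.prems by (intro Suc.IH) simp
    then have half: "(\<lambda>k. 1 - 4 * (1 - Re (char (\<mu> k) (u / 2)))) \<longlonglongrightarrow> 1"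
      by (auto intro!: tendsto_eq_intros)
    have le: "cmod (char (\<mu> k) u) \<le> 1" for k
      by (rule \<mu>.cmod_char_le_1)
    have Re: "(\<lambda>k. Re (char (\<mu> k) u)) \<longlonglongrightarrow> 1"
    proof (rule tendsto_sandwich[OF _ _ half tendsto_const])
      show "\<forall>\<^sub>F k in sequentially. 1 - 4 * (1 - Re (char (\<mu> k) (u / 2))) \<le> Re (char (\<mu> k) u)"
        using \<mu>.one_minus_Re_char_double[of _ "u / 2"] by (intro always_eventually) (simp add: algebra_simps)
      show "\<forall>\<^sub>F k in sequentially. Re (char (\<mu> k) u) \<le> 1"
        using order_trans[OF complex_Re_le_cmod le] by simp
    qed
    \<comment> \<open>Since the modulus is at most 1, a real part tending to 1 leaves no room for
      the imaginary part.\<close>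
    have "(\<lambda>k. (Im (char (\<mu> k) u))\<^sup>2) \<longlonglongrightarrow> 0"
    proof (rule tendsto_sandwich[OF _ _ tendsto_const])
      show "(\<lambda>k. 1 - (Re (char (\<mu> k) u))\<^sup>2) \<longlonglongrightarrow> 0"
        using tendsto_diff[OF tendsto_const tendsto_power[OF Re, of 2], of 1] by simp
      show "\<forall>\<^sub>F k in sequentially. (Im (char (\<mu> k) u))\<^sup>2 \<le> 1 - (Re (char (\<mu> k) u))\<^sup>2"
      proof (intro always_eventually allI)
        fix k
        have "(cmod (char (\<mu> k) u))\<^sup>2 \<le> 1"
          using le[of k] by (simp add: power_le_one)
        then show "(Im (char (\<mu> k) u))\<^sup>2 \<le> 1 - (Re (char (\<mu> k) u))\<^sup>2"
          by (simp add: cmod_power2)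
      qed
    qed simp
    then have "(\<lambda>k. Im (char (\<mu> k) u)) \<longlonglongrightarrow> 0"
      using tendsto_real_sqrt by (fastforce simp: tendsto_rabs_zero_iff)
    with Re show ?case
      by (simp add: tendsto_complex_iff)
  qed
  obtain n where "\<bar>u\<bar> / \<delta> < 2 ^ n"
    using real_arch_pow[of 2 "\<bar>u\<bar> / \<delta>"] by auto
  then show ?thesis
    using \<open>\<delta> > 0\<close> by (intro dyadic[of u n]) (simp add: field_simps)
qed

text \<open>The constant 1 is the characteristic function of the point mass at 0, so Levy continuity
  gives weak convergence to it, and the truncated absolute value is a bounded continuous test
  function vanishing at 0. Its expectation measures convergence in probability from here on.\<close>

lemma expectation_truncated_tendsto_0:
  fixes X :: "nat \<Rightarrow> 'a \<Rightarrow> real"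
  assumes "prob_space M" and [measurable]: "\<And>k. X k \<in> borel_measurable M"
    and char_lim: "\<And>u. (\<lambda>k. char (distr M borel (X k)) u) \<longlonglongrightarrow> 1"
  shows "(\<lambda>k. \<integral>\<omega>. min 1 \<bar>X k \<omega>\<bar> \<partial>M) \<longlonglongrightarrow> 0"
proof -
  interpret prob_space M by fact
  have rd: "real_distribution (distr M borel (X k))" for k
    by (rule real_distribution_distr) simp
  have rd0: "real_distribution (return borel 0)"
    by (auto simp: real_distribution_def real_distribution_axioms_def prob_space_return)
  have "char (return borel 0) u = 1" for u
    by (simp add: char_def integral_return)
  then have "weak_conv_m (\<lambda>k. distr M borel (X k)) (return borel 0)"
    using char_lim by (intro levy_continuity rd rd0) simp
  then have "(\<lambda>k. \<integral>x. min 1 \<bar>x\<bar> \<partial>distr M borel (X k)) \<longlonglongrightarrow> (\<integral>x. min 1 \<bar>x\<bar> \<partial>return borel (0::real))"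
    by (rule weak_conv_imp_integral_bdd_continuous_conv[OF rd rd0, where B = 1])
       (auto intro!: continuous_intros)
  then show ?thesis
    by (simp add: integral_distr integral_return)
qed

section \<open>Series of independent random variables\<close>

text \<open>If the claim failed, there would be blocks from \<open>Suc (m K)\<close> to
  \<open>n K\<close>, arbitrarily far out, with truncated expectation at least \<open>e\<close>.
  Independence makes the characteristic function of a block a quotient of those of two partial sums,
  which tends to 1 near 0 and hence everywhere, a contradiction.\<close>

lemma (in prob_space) indep_series_differences_tendsto_0:
  fixes X :: "nat \<Rightarrow> 'a \<Rightarrow> real"
  assumes indep: "indep_vars (\<lambda>_. borel) X {1..}" and N: "prob_space N"
    and conv: "converges_in_distribution M (\<lambda>t \<omega>. \<Sum>k=1..t. X k \<omega>) N Z"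
    and e: "e > 0"
  shows "\<exists>K. \<forall>m\<ge>K. \<forall>n\<ge>m. (\<integral>\<omega>. min 1 \<bar>\<Sum>k=Suc m..n. X k \<omega>\<bar> \<partial>M) < e"
proof (rule ccontr)
  assume "\<nexists>K. \<forall>m\<ge>K. \<forall>n\<ge>m. (\<integral>\<omega>. min 1 \<bar>\<Sum>k=Suc m..n. X k \<omega>\<bar> \<partial>M) < e"
  then have "\<forall>K. \<exists>m n. m \<ge> K \<and> n \<ge> m \<and> (\<integral>\<omega>. min 1 \<bar>\<Sum>k=Suc m..n. X k \<omega>\<bar> \<partial>M) \<ge> e"
    by (meson not_le)
  then obtain m n where mn: "\<And>K. m K \<ge> K" "\<And>K. n K \<ge> m K"
    and ge: "\<And>K. (\<integral>\<omega>. min 1 \<bar>\<Sum>k=Suc (m K)..n K. X k \<omega>\<bar> \<partial>M) \<ge> e"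
    by metis
  interpret N: prob_space N by fact
  have [measurable]: "Z \<in> borel_measurable N"
    using conv by (simp add: converges_in_distribution_def)
  have X_rv [measurable]: "k \<ge> 1 \<Longrightarrow> X k \<in> borel_measurable M" for k
    using indep by (simp add: indep_vars_def)
  have diff_rv [measurable]: "(\<lambda>\<omega>. \<Sum>k=Suc i..j. X k \<omega>) \<in> borel_measurable M" for i j
    by (intro borel_measurable_sum X_rv) simp
  define \<phi> where "\<phi> t u = char (distr M borel (\<lambda>\<omega>. \<Sum>k=1..t. X k \<omega>)) u" for t u
  define \<psi> where "\<psi> K u = char (distr M borel (\<lambda>\<omega>. \<Sum>k=Suc (m K)..n K. X k \<omega>)) u" for K u
  define \<phi>Z where "\<phi>Z = char (distr N borel Z)"
  have rdZ: "real_distribution (distr N borel Z)"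
    by (rule N.real_distribution_distr) simp
  have \<phi>_lim: "(\<lambda>t. \<phi> t u) \<longlonglongrightarrow> \<phi>Z u" for u
    unfolding \<phi>_def \<phi>Z_def by (rule converges_in_distribution_char[OF prob_space_axioms N conv])
  \<comment> \<open>Stated as a product, since division by \<open>\<phi> (m K) u\<close> becomes
    legitimate only for large \<open>K\<close> and for \<open>u\<close> near 0.\<close>
  have factor: "\<phi> (n K) u = \<phi> (m K) u * \<psi> K u" for K u
  proof -
    have split: "{1..n K} = {1..m K} \<union> {Suc (m K)..n K}"
      using mn(2)[of K] by auto
    have "(\<Prod>k=1..n K. char (distr M borel (X k)) u) =
        (\<Prod>k=1..m K. char (distr M borel (X k)) u) * (\<Prod>k=Suc (m K)..n K. char (distr M borel (X k)) u)"
      unfolding split by (rule prod.union_disjoint) auto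
    moreover have "char (distr M borel (\<lambda>\<omega>. \<Sum>k\<in>A. X k \<omega>)) u = (\<Prod>k\<in>A. char (distr M borel (X k)) u)"
      if "A \<subseteq> {1..}" for A
      by (rule char_distr_sum[OF indep_vars_subset[OF indep that]])
    ultimately show ?thesis
      unfolding \<phi>_def \<psi>_def by simp
  qed
  have m_top: "filterlim m at_top sequentially"
    by (rule filterlim_at_top_mono[OF filterlim_ident]) (use mn in auto)
  have n_top: "filterlim n at_top sequentially"
    by (rule filterlim_at_top_mono[OF m_top]) (use mn in auto)
  have "\<phi>Z 0 = 1"
    using real_distribution.char_zero[OF rdZ] by (simp add: \<phi>Z_def)
  moreover have "isCont \<phi>Z 0"
    using real_distribution.isCont_char[OF rdZ] by (simp add: \<phi>Z_def)
  \<comment> \<open>Distance less than 1 from the value 1 keeps \<open>\<phi>Z\<close> away from 0.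
    The radius is halved below to turn the strict bound on \<open>u\<close> into the closed one that
    \<open>char_tendsto_1_everywhere\<close> expects.\<close>
  ultimately have "\<exists>d>0. \<forall>u. norm (u - 0) < d \<longrightarrow> norm (\<phi>Z u - 1) < 1"
    unfolding continuous_at_eps_delta dist_norm by (metis zero_less_one)
  then obtain d where "d > 0" and d: "\<And>u. \<bar>u\<bar> < d \<Longrightarrow> norm (\<phi>Z u - 1) < 1"
    by auto
  have "(\<lambda>K. \<psi> K u) \<longlonglongrightarrow> 1" if "\<bar>u\<bar> \<le> d / 2" for u
  proof -
    have nz: "\<phi>Z u \<noteq> 0"
      using d[of u] that \<open>d > 0\<close> by auto
    have m_lim: "(\<lambda>K. \<phi> (m K) u) \<longlonglongrightarrow> \<phi>Z u" and n_lim: "(\<lambda>K. \<phi> (n K) u) \<longlonglongrightarrow> \<phi>Z u"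
      using filterlim_compose[OF \<phi>_lim m_top] filterlim_compose[OF \<phi>_lim n_top] by auto
    have "(\<lambda>K. \<phi> (n K) u / \<phi> (m K) u) \<longlonglongrightarrow> \<phi>Z u / \<phi>Z u"
      by (intro tendsto_divide m_lim n_lim nz)
    moreover have "eventually (\<lambda>K. \<phi> (m K) u \<noteq> 0) sequentially"
      using m_lim nz by (rule tendsto_imp_eventually_ne)
    then have "eventually (\<lambda>K. \<phi> (n K) u / \<phi> (m K) u = \<psi> K u) sequentially"
      by eventually_elim (simp add: factor)
    ultimately show ?thesis
      using nz by (simp add: tendsto_cong)
  qed
  then have near: "(\<lambda>K. char (distr M borel (\<lambda>\<omega>. \<Sum>k=Suc (m K)..n K. X k \<omega>)) u) \<longlonglongrightarrow> 1"
    if "\<bar>u\<bar> \<le> d / 2" for u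
    using that unfolding \<psi>_def .
  have "(\<lambda>K. char (distr M borel (\<lambda>\<omega>. \<Sum>k=Suc (m K)..n K. X k \<omega>)) u) \<longlonglongrightarrow> 1" for u
    by (rule char_tendsto_1_everywhere[where \<delta> = "d / 2", OF real_distribution_distr[OF diff_rv] _ near])
       (use \<open>d > 0\<close> in simp_all)
  then have "(\<lambda>K. \<integral>\<omega>. min 1 \<bar>\<Sum>k=Suc (m K)..n K. X k \<omega>\<bar> \<partial>M) \<longlonglongrightarrow> 0"
    by (rule expectation_truncated_tendsto_0[OF prob_space_axioms diff_rv])
  then have "e \<le> 0"
    using ge by (intro LIMSEQ_le_const) auto
  with e show False by simp
qed

text \<open>Along a subsequence whose successive truncated distances have expectations bounded by a
  geometric sequence, these distances are almost surely summable, so the telescoping series of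
  increments converges absolutely.\<close>

lemma (in prob_space) Cauchy_in_probability_imp_AE_subseq:
  fixes S :: "nat \<Rightarrow> 'a \<Rightarrow> 'v::{banach, second_countable_topology}"
  assumes [measurable]: "\<And>n. S n \<in> borel_measurable M"
    and Cauchy: "\<And>e. e > 0 \<Longrightarrow> \<exists>K. \<forall>m\<ge>K. \<forall>n\<ge>m. (\<integral>\<omega>. min 1 (norm (S n \<omega> - S m \<omega>)) \<partial>M) < e"
  obtains r V where "strict_mono r" "V \<in> borel_measurable M" "AE \<omega> in M. (\<lambda>k. S (r k) \<omega>) \<longlonglongrightarrow> V \<omega>"
proof -
  define d where "d m n \<omega> = min 1 (norm (S n \<omega> - S m \<omega>))" for m n \<omega>
  have [measurable]: "d m n \<in> borel_measurable M" for m n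
    unfolding d_def by measurable
  have d_int: "integrable M (d m n)" for m n
    by (rule integrable_const_bound[where B = 1]) (auto simp: d_def)
  \<comment> \<open>The bound is required for all \<open>n\<close> from \<open>r k\<close> on, so
    that it covers \<open>r (Suc k)\<close>, which is chosen only afterwards.\<close>
  have "\<exists>r. \<forall>k. (\<forall>n\<ge>r k. expectation (d (r k) n) < (1/2) ^ k) \<and> r k < r (Suc k)"
  proof (rule dependent_nat_choice)
    show "\<exists>x. \<forall>n\<ge>x. expectation (d x n) < (1/2) ^ 0"
      using Cauchy[of 1] by (auto simp: d_def[abs_def])
  next
    fix x k assume "\<forall>n\<ge>x. expectation (d x n) < (1/2) ^ k"
    obtain K where K: "\<And>m n. m \<ge> K \<Longrightarrow> n \<ge> m \<Longrightarrow> expectation (d m n) < (1/2) ^ Suc k"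
      using Cauchy[of "(1/2) ^ Suc k"] by (auto simp: d_def[abs_def])
    then show "\<exists>y. (\<forall>n\<ge>y. expectation (d y n) < (1/2) ^ Suc k) \<and> x < y"
      by (intro exI[of _ "max K (Suc x)"]) auto
  qed
  then obtain r where r: "\<And>k n. n \<ge> r k \<Longrightarrow> expectation (d (r k) n) < (1/2) ^ k"
    and r_less: "\<And>k. r k < r (Suc k)" by blast
  define f where "f k = d (r k) (r (Suc k))" for k
  have f_nn: "0 \<le> f k \<omega>" for k \<omega> by (simp add: f_def d_def)
  have [measurable]: "f k \<in> borel_measurable M" for k
    by (simp add: f_def)
  have f_exp: "expectation (f k) \<le> (1/2) ^ k" for k
    using r[of k "r (Suc k)"] r_less[of k] by (simp add: f_def)
  have "(\<integral>\<^sup>+ \<omega>. (\<Sum>k. ennreal (f k \<omega>)) \<partial>M) = (\<Sum>k. \<integral>\<^sup>+ \<omega>. ennreal (f k \<omega>) \<partial>M)"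
    by (rule nn_integral_suminf) simp
  also have "\<dots> = (\<Sum>k. ennreal (expectation (f k)))"
    using d_int f_nn by (intro arg_cong[where f = suminf] ext nn_integral_eq_integral) (auto simp: f_def)
  also have "\<dots> \<le> (\<Sum>k. ennreal ((1/2) ^ k))"
    by (intro suminf_le ennreal_leI f_exp) auto
  also have "\<dots> = ennreal (\<Sum>k. (1/2) ^ k)"
    by (rule suminf_ennreal2) (auto intro: summable_geometric)
  also have "\<dots> < \<infinity>" by simp
  finally have "AE \<omega> in M. (\<Sum>k. ennreal (f k \<omega>)) \<noteq> \<infinity>"
    by (intro nn_integral_PInf_AE) auto
  then have AE_conv: "AE \<omega> in M. convergent (\<lambda>k. S (r k) \<omega>)"
  proof eventually_elim
    fix \<omega> assume "(\<Sum>k. ennreal (f k \<omega>)) \<noteq> \<infinity>"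
    then have f_sum: "summable (\<lambda>k. f k \<omega>)"
      by (intro summable_suminf_not_top f_nn) (simp add: infinity_ennreal_def)
    \<comment> \<open>Once a term is below 1 the truncation is inactive and the term equals the norm
      of the increment.\<close>
    then have "eventually (\<lambda>k. f k \<omega> < 1) sequentially"
      using summable_LIMSEQ_zero order_tendstoD(2) zero_less_one by blast
    then have "eventually (\<lambda>k. norm (S (r (Suc k)) \<omega> - S (r k) \<omega>) \<le> f k \<omega>) sequentially"
      by eventually_elim (auto simp: f_def d_def)
    then have "summable (\<lambda>k. S (r (Suc k)) \<omega> - S (r k) \<omega>)"
      by (rule summable_comparison_test_ev[OF _ f_sum])
    then have "convergent (\<lambda>n. \<Sum>k<n. S (r (Suc k)) \<omega> - S (r k) \<omega>)"
      by (simp add: summable_iff_convergent)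
    then have "convergent (\<lambda>n. S (r n) \<omega> - S (r 0) \<omega>)"
      by (simp add: sum_lessThan_telescope[of "\<lambda>k. S (r k) \<omega>"])
    then show "convergent (\<lambda>k. S (r k) \<omega>)"
      using convergent_add[OF _ convergent_const[of "S (r 0) \<omega>"]] by fastforce
  qed
  show thesis
  proof
    show "strict_mono r" using r_less by (simp add: strict_mono_Suc_iff)
    \<comment> \<open>\<open>lim\<close> is a total function; its value at points of divergence is
      immaterial, as these form a null set.\<close>
    show "(\<lambda>\<omega>. lim (\<lambda>k. S (r k) \<omega>)) \<in> borel_measurable M"
      by (rule borel_measurable_lim_metric) simp
    show "AE \<omega> in M. (\<lambda>k. S (r k) \<omega>) \<longlonglongrightarrow> lim (\<lambda>k. S (r k) \<omega>)"
      using AE_conv by eventually_elim (simp add: convergent_LIMSEQ_iff)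
  qed
qed

text \<open>The real-valued result is applied to each coordinate, and the norm is bounded by the sum
  of the absolute coordinates. The partial sums are therefore Cauchy in probability.\<close>

lemma (in prob_space) indep_series_AE_subseq:
  fixes X :: "nat \<Rightarrow> 'a \<Rightarrow> 'v::euclidean_space"
  assumes indep: "indep_vars (\<lambda>_. borel) X {1..}" and N: "prob_space N"
    and conv: "converges_in_distribution M (\<lambda>t \<omega>. \<Sum>k=1..t. X k \<omega>) N Z"
  obtains r V where "strict_mono r" "V \<in> borel_measurable M"
    "AE \<omega> in M. (\<lambda>j. \<Sum>k=1..r j. X k \<omega>) \<longlonglongrightarrow> V \<omega>"
proof (rule Cauchy_in_probability_imp_AE_subseq)
  define S where "S t \<omega> = (\<Sum>k=1..t. X k \<omega>)" for t \<omega>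
  show [measurable]: "(\<lambda>\<omega>. \<Sum>k=1..t. X k \<omega>) \<in> borel_measurable M" for t
    using conv by (simp add: converges_in_distribution_def)
  have diff: "(\<Sum>k=1..n. X k \<omega>) - (\<Sum>k=1..m. X k \<omega>) = (\<Sum>k=Suc m..n. X k \<omega>)" if "n \<ge> m" for m n \<omega>
    using that sum.ub_add_nat[of 1 m "\<lambda>k. X k \<omega>" "n - m"] by simp
  fix e :: real assume "e > 0"
  \<comment> \<open>Each coordinate receives an equal share of \<open>e\<close>, so that the shares
    add up to \<open>e\<close> over the basis.\<close>
  have "\<exists>K. \<forall>m\<ge>K. \<forall>n\<ge>m. (\<integral>\<omega>. min 1 \<bar>(\<Sum>k=Suc m..n. X k \<omega>) \<bullet> b\<bar> \<partial>M) < e / DIM('v)" for b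
  proof -
    have "\<exists>K. \<forall>m\<ge>K. \<forall>n\<ge>m. (\<integral>\<omega>. min 1 \<bar>\<Sum>k=Suc m..n. X k \<omega> \<bullet> b\<bar> \<partial>M) < e / DIM('v)"
    proof (rule indep_series_differences_tendsto_0[OF _ N])
      show "indep_vars (\<lambda>_. borel) (\<lambda>k \<omega>. X k \<omega> \<bullet> b) {1..}"
        by (rule indep_vars_compose2[OF indep]) simp
      show "converges_in_distribution M (\<lambda>t \<omega>. \<Sum>k=1..t. X k \<omega> \<bullet> b) N (\<lambda>\<omega>. Z \<omega> \<bullet> b)"
        unfolding inner_sum_left[symmetric]
        by (intro converges_in_distribution_compose[OF conv] continuous_intros)
    qed (use \<open>e > 0\<close> in simp)
    then show ?thesis by (simp add: inner_sum_left)
  qed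
  then obtain K where K: "\<And>b m n. m \<ge> K b \<Longrightarrow> n \<ge> m \<Longrightarrow>
      (\<integral>\<omega>. min 1 \<bar>(\<Sum>k=Suc m..n. X k \<omega>) \<bullet> b\<bar> \<partial>M) < e / DIM('v)"
    by metis
  show "\<exists>K. \<forall>m\<ge>K. \<forall>n\<ge>m. (\<integral>\<omega>. min 1 (norm ((\<Sum>k=1..n. X k \<omega>) - (\<Sum>k=1..m. X k \<omega>))) \<partial>M) < e"
  proof (intro exI allI impI)
    \<comment> \<open>The basis is finite, so one threshold serves all coordinates.\<close>
    fix m n assume m: "m \<ge> Max (K ` Basis)" and n: "n \<ge> m"
    have m_ge: "m \<ge> K b" if "b \<in> Basis" for b
      using m that by (meson Max_ge finite_Basis finite_imageI imageI order_trans)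
    define T where "T \<omega> = (\<Sum>k=Suc m..n. X k \<omega>)" for \<omega>
    have [measurable]: "T \<in> borel_measurable M"
    proof -
      have "T = (\<lambda>\<omega>. (\<Sum>k=1..n. X k \<omega>) - (\<Sum>k=1..m. X k \<omega>))"
        using diff[OF n] by (simp add: T_def fun_eq_iff)
      also have "\<dots> \<in> borel_measurable M" by measurable
      finally show ?thesis .
    qed
    have int: "integrable M (\<lambda>\<omega>. min 1 \<bar>T \<omega> \<bullet> b\<bar>)" for b
      by (rule integrable_const_bound[where B = 1]) auto
    \<comment> \<open>Truncation at 1 is subadditive on nonnegative terms, which moves it inside the
      sum over coordinates.\<close>
    have min_sum: "min 1 (\<Sum>b\<in>A. a b) \<le> (\<Sum>b\<in>A. min 1 (a b))"
      if "finite A" "\<And>b. 0 \<le> a b" for A :: "'v set" and a :: "'v \<Rightarrow> real"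
      using that(1)
    proof induction
      case (insert x F)
      have "0 \<le> (\<Sum>b\<in>F. a b)" by (intro sum_nonneg that)
      with insert that(2)[of x] show ?case by simp
    qed simp
    have "(\<integral>\<omega>. min 1 (norm (T \<omega>)) \<partial>M) \<le> (\<integral>\<omega>. (\<Sum>b\<in>Basis. min 1 \<bar>T \<omega> \<bullet> b\<bar>) \<partial>M)"
    proof (rule integral_mono)
      show "integrable M (\<lambda>\<omega>. min 1 (norm (T \<omega>)))"
        by (rule integrable_const_bound[where B = 1]) auto
      show "min 1 (norm (T \<omega>)) \<le> (\<Sum>b\<in>Basis. min 1 \<bar>T \<omega> \<bullet> b\<bar>)" for \<omega>
        using norm_le_l1[of "T \<omega>"] min_sum[of Basis "\<lambda>b. \<bar>T \<omega> \<bullet> b\<bar>"] by simp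
    qed (simp add: int)
    also have "\<dots> = (\<Sum>b\<in>Basis. \<integral>\<omega>. min 1 \<bar>T \<omega> \<bullet> b\<bar> \<partial>M)"
      by (rule Bochner_Integration.integral_sum) (rule int)
    also have "\<dots> < (\<Sum>b\<in>(Basis :: 'v set). e / DIM('v))"
      unfolding T_def by (intro sum_strict_mono K m_ge n) auto
    also have "\<dots> = e" by simp
    finally show "(\<integral>\<omega>. min 1 (norm ((\<Sum>k=1..n. X k \<omega>) - (\<Sum>k=1..m. X k \<omega>))) \<partial>M) < e"
      unfolding diff[OF n] T_def .
  qed
qed (use that in blast)

section \<open>Matrix powers, rank and inverses\<close>

lemma cmat_mat_1: "cmat (mat 1) = mat 1"
  by (simp add: vec_eq_iff mat_def)

lemma cmat_eq_mat_1_iff: "cmat A = mat 1 \<longleftrightarrow> A = mat 1"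
  by (auto simp: vec_eq_iff mat_def split: if_splits)

lemma matpow_mat_1: "matpow (mat 1) k = mat 1"
  by (induction k) simp_all

text \<open>Full row rank says that the rows span the space, which is left invertibility and, for
  square matrices, invertibility.\<close>

lemma full_rank_iff_invertible:
  fixes A :: "'a::field^'n^'n"
  shows "rank A = CARD('n) \<longleftrightarrow> invertible A"
  by (simp add: row_rank_def_gen invertible_left_inverse matrix_left_invertible_span_rows_gen
      vec.dim_eq_full[symmetric] card_cart_basis vec.dimension_def)

lemma invertible_mat_1: "invertible (mat 1 :: 'a::semiring_1^'n^'n)"
  unfolding invertible_def by (intro exI[of _ "mat 1"]) simp

lemma matrix_inv_inverse:
  assumes "invertible A"
  shows "A ** matrix_inv A = mat 1" "matrix_inv A ** A = mat 1"
  using someI_ex[OF assms[unfolded invertible_def]] unfolding matrix_inv_def by auto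

text \<open>Shifting the index in the limit gives \<open>A ** L = L\<close>, and an invertible
  \<open>L\<close> can be cancelled.\<close>

lemma matpow_limit_invertible_imp_mat_1:
  fixes A :: "complex^'n^'n"
  assumes lim: "(\<lambda>t. matpow A t) \<longlonglongrightarrow> L" and L: "invertible L"
  shows "A = mat 1"
proof -
  have entry: "(\<lambda>t. matpow A t $ i $ j) \<longlonglongrightarrow> L $ i $ j" for i j
    by (intro tendsto_vec_nth lim)
  have "(\<lambda>t. (A ** matpow A t) $ i $ j) \<longlonglongrightarrow> (A ** L) $ i $ j" for i j
    by (simp add: matrix_matrix_mult_def) (intro tendsto_intros entry)
  moreover have "(\<lambda>t. (A ** matpow A t) $ i $ j) \<longlonglongrightarrow> L $ i $ j" for i j
    using LIMSEQ_Suc[OF entry] by simp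
  ultimately have "A ** L = L"
    using LIMSEQ_unique by (fastforce simp: vec_eq_iff)
  then have "A ** (L ** matrix_inv L) = L ** matrix_inv L"
    by (simp add: matrix_mul_assoc)
  then show ?thesis
    by (simp add: matrix_inv_inverse[OF L])
qed

section \<open>Two limiting factors and the identity matrix\<close>

theorem mainTheorem2:
  fixes M :: "'a measure" and N :: "'b measure" and N' :: "'c measure"
    and Y :: "nat \<Rightarrow> 'a \<Rightarrow> real^'p" and \<eta> :: "nat \<Rightarrow> 'a \<Rightarrow> real^2"
    and W :: "nat \<Rightarrow> 'a \<Rightarrow> real^2" and \<epsilon> :: "'a \<Rightarrow> real^'p"
    and \<Lambda> :: "real^2^'p" and B :: "real^2^2" and Q D :: "complex^2^2"
    and Ystar :: "'b \<Rightarrow> real^'p" and Wstar :: "'c \<Rightarrow> real^2"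
  assumes prob: "prob_space M" "prob_space N" "prob_space N'"
    and eta_rv: "\<And>t. \<eta> t \<in> borel_measurable M"
    and eps_indep: "prob_space.indep_vars M (\<lambda>_. borel) (\<lambda>i \<omega>. \<epsilon> \<omega> $ i) UNIV"
    and eps_normal: "\<And>i. normal_rv M (\<lambda>\<omega>. \<epsilon> \<omega> $ i)"
    and W_indep: "prob_space.indep_vars M (\<lambda>_. borel) W {1..}"
    and W_normal: "\<And>t. t \<ge> 1 \<Longrightarrow> multivariate_normal M (W t)"
    and measurement: "\<And>t \<omega>. \<omega> \<in> space M \<Longrightarrow> Y t \<omega> = \<Lambda> *v \<eta> t \<omega> + \<epsilon> \<omega>"
    and dynamics: "\<And>t \<omega>. t \<ge> 1 \<Longrightarrow> \<omega> \<in> space M \<Longrightarrow> \<eta> t \<omega> = B *v \<eta> (t - 1) \<omega> + W t \<omega>"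
    and jordan: "invertible Q" "jordan_form2 D" "cmat B = Q ** D ** matrix_inv Q"
    and Y_conv: "converges_in_distribution M Y N Ystar"
    and B_inv: "invertible B"
    and W_conv: "converges_in_distribution M
        (\<lambda>t \<omega>. \<Sum>k=1..t. matpow (matrix_inv B) k *v W k \<omega>) N' Wstar"
    and Wstar_normal: "multivariate_normal N' Wstar"
  shows "(\<exists>r \<Lambda>star \<eta>star.
            limiting_factor_model M \<Lambda> Q D (\<eta> 0) \<epsilon> (distr N' borel Wstar) (distr N borel Ystar)
              r \<Lambda>star \<eta>star \<and> r = 2)
         \<longleftrightarrow> B = mat 1"
proof
  assume "\<exists>r \<Lambda>star \<eta>star.
            limiting_factor_model M \<Lambda> Q D (\<eta> 0) \<epsilon> (distr N' borel Wstar) (distr N borel Ystar)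
              r \<Lambda>star \<eta>star \<and> r = 2"
  \<comment> \<open>Writing 2 as \<open>CARD(2)\<close> lets the rank condition be read as
    invertibility of \<open>Dstar\<close>.\<close>
  then obtain Dstar where "(\<lambda>t. matpow D t) \<longlonglongrightarrow> Dstar" "rank Dstar = CARD(2)"
    unfolding limiting_factor_model_def by auto
  then have "D = mat 1"
    unfolding full_rank_iff_invertible by (rule matpow_limit_invertible_imp_mat_1)
  then show "B = mat 1"
    using jordan(3) matrix_inv_inverse(1)[OF jordan(1)] by (simp add: cmat_eq_mat_1_iff)
next
  assume B: "B = mat 1"
  interpret prob_space M by (rule prob)
  have "Q ** D ** matrix_inv Q = mat 1"
    using jordan(3) B cmat_mat_1 by metis
  then have "matrix_inv Q ** (Q ** D ** matrix_inv Q) ** Q = mat 1"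
    by (simp add: matrix_inv_inverse[OF jordan(1)])
  then have "(matrix_inv Q ** Q) ** D ** (matrix_inv Q ** Q) = mat 1"
    by (simp only: matrix_mul_assoc)
  then have D: "D = mat 1"
    by (simp add: matrix_inv_inverse[OF jordan(1)])
  have "matrix_inv (mat 1 :: real^2^2) = mat 1"
    using matrix_inv_inverse(1)[of "mat 1 :: real^2^2"] invertible_mat_1 by simp
  then have S_conv: "converges_in_distribution M (\<lambda>t \<omega>. \<Sum>k=1..t. W k \<omega>) N' Wstar"
    using W_conv by (simp add: B matpow_mat_1)
  \<comment> \<open>\<open>Wstar\<close> lives on \<open>N'\<close>, whereas the limiting model adds
    the noise limit to \<open>\<eta> 0\<close> and \<epsilon> on \<open>M\<close>.
    \<open>Winf\<close> is a copy on \<open>M\<close>, obtained as an almost sure limit so that its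
    joint behaviour with \<open>\<eta> 0\<close> and \<epsilon> is the right one.\<close>
  obtain r Winf where r: "strict_mono r" and [measurable]: "Winf \<in> borel_measurable M"
    and Winf_lim: "AE \<omega> in M. (\<lambda>j. \<Sum>k=1..r j. W k \<omega>) \<longlonglongrightarrow> Winf \<omega>"
    by (rule indep_series_AE_subseq[OF W_indep prob(3) S_conv])
  have Winf_law: "distr M borel Winf = distr N' borel Wstar"
    by (rule converges_in_distribution_AE_limit[OF prob(1,3) S_conv r _ Winf_lim]) simp
  have \<eta>_eq: "\<eta> t \<omega> = \<eta> 0 \<omega> + (\<Sum>k=1..t. W k \<omega>)" if "\<omega> \<in> space M" for t \<omega>
    using dynamics[OF _ that] by (induction t) (simp_all add: B)
  define Yinf where "Yinf \<omega> = \<Lambda> *v (\<eta> 0 \<omega> + Winf \<omega>) + \<epsilon> \<omega>" for \<omega>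
  \<comment> \<open>The subsequence chosen for the noise also carries \<open>Y\<close>, since for
    \<open>B = mat 1\<close> each \<open>Y t\<close> is a fixed continuous function of
    \<open>\<eta> 0\<close>, the partial sum of the noise and \<epsilon>.\<close>
  have Yinf_lim: "AE \<omega> in M. (\<lambda>j. Y (r j) \<omega>) \<longlonglongrightarrow> Yinf \<omega>"
    using Winf_lim AE_space
  proof eventually_elim
    case (elim \<omega>)
    have "(\<lambda>j. \<Lambda> *v (\<eta> 0 \<omega> + (\<Sum>k=1..r j. W k \<omega>)) + \<epsilon> \<omega>) \<longlonglongrightarrow> Yinf \<omega>"
      unfolding Yinf_def
      by (intro tendsto_add tendsto_const elim
          bounded_linear.tendsto[OF matrix_vector_mul_bounded_linear])
    then show ?case
      using elim by (simp add: measurement \<eta>_eq[of \<omega> "r _"])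
  qed
  have [measurable]: "\<epsilon> \<in> borel_measurable M"
  proof (rule borel_measurable_euclidean_space[THEN iffD2], intro ballI)
    fix b :: "real^'p" assume "b \<in> Basis"
    then obtain i where "b = axis i 1" by (auto simp: Basis_vec_def)
    then show "(\<lambda>\<omega>. \<epsilon> \<omega> \<bullet> b) \<in> borel_measurable M"
      using eps_normal[of i] by (simp add: inner_axis normal_rv_def)
  qed
  have [measurable]: "(\<lambda>x. \<Lambda> *v x) \<in> borel_measurable borel"
    by (intro borel_measurable_continuous_onI linear_continuous_on matrix_vector_mul_bounded_linear)
  have [measurable]: "\<eta> 0 \<in> borel_measurable M"
    by (rule eta_rv)
  have "Yinf \<in> borel_measurable M"
    unfolding Yinf_def by measurable
  then have Yinf_law: "distr M borel Yinf = distr N borel Ystar"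
    by (rule converges_in_distribution_AE_limit[OF prob(1,2) Y_conv r _ Yinf_lim])
  \<comment> \<open>The identity is factored trivially: the standard basis vectors serve both as the
    columns \<open>C\<close> and as the rows \<open>G\<close>, indexed from 0 while vector
    components are indexed from 1.\<close>
  define e :: "nat \<Rightarrow> real^2" where "e j = (if j = 0 then axis 1 1 else axis 2 1)" for j
  have expand: "(\<Sum>j<2. (e j \<bullet> v) *\<^sub>R (\<Lambda> *v e j)) = \<Lambda> *v v" for v
  proof -
    have "(\<Sum>j<2. (e j \<bullet> v) *\<^sub>R e j) = v"
      by (simp add: numeral_2_eq_2 e_def inner_vec_def sum_2 vec_eq_iff forall_2 axis_def)
    then have "\<Lambda> *v v = \<Lambda> *v (\<Sum>j<2. (e j \<bullet> v) *\<^sub>R e j)" by simp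
    also have "\<dots> = (\<Sum>j<2. (e j \<bullet> v) *\<^sub>R (\<Lambda> *v e j))"
      by (simp add: linear_sum[OF matrix_vector_mul_linear] matrix_vector_mult_scaleR)
    finally show ?thesis by simp
  qed
  have "limiting_factor_model M \<Lambda> Q D (\<eta> 0) \<epsilon> (distr N' borel Wstar) (distr N borel Ystar)
      2 (\<lambda>j. \<Lambda> *v e j) (\<lambda>j \<omega>. e j \<bullet> (\<eta> 0 \<omega> + Winf \<omega>))"
    unfolding limiting_factor_model_def
  proof (intro exI conjI)
    show "(\<lambda>t. matpow D t) \<longlonglongrightarrow> mat 1"
      by (simp add: D matpow_mat_1)
    show "2 = rank (mat 1 :: complex^2^2)"
      using full_rank_iff_invertible[of "mat 1 :: complex^2^2"] invertible_mat_1 by simp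
    have "(\<chi> i k. \<Sum>j<2. e j $ i * e j $ k) = mat 1"
      by (simp add: numeral_2_eq_2 e_def vec_eq_iff forall_2 axis_def mat_def)
    then show "cmat (\<chi> i k. \<Sum>j<2. e j $ i * e j $ k) = Q ** mat 1 ** matrix_inv Q"
      by (simp add: cmat_eq_mat_1_iff matrix_inv_inverse[OF jordan(1)])
    show "distr M borel (\<lambda>\<omega>. (\<Sum>j<2. (e j \<bullet> (\<eta> 0 \<omega> + Winf \<omega>)) *\<^sub>R (\<Lambda> *v e j)) + \<epsilon> \<omega>)
        = distr N borel Ystar"
      using Yinf_law by (simp add: expand Yinf_def[abs_def])
  qed (use Winf_law in auto)
  then show "\<exists>r \<Lambda>star \<eta>star.
            limiting_factor_model M \<Lambda> Q D (\<eta> 0) \<epsilon> (distr N' borel Wstar) (distr N borel Ystar)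
              r \<Lambda>star \<eta>star \<and> r = 2"
    by blast
qed

end
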